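(* Let $p_1,\dots,p_n\in\mathbb{R}^d$, let $W\in\mathcal{S}^n$ be the Gram matrix $W_{ij}=p_i^\top p_j$, let $c_1,\dots,c_k$ be positive integers with $\sum_{j=1}^kc_j=n$, and let $L_{=},L_{\neq}\subset[n]\times[n]$ be sets of must-link and cannot-link constraints. Consider the problem (A) in variables $\pi_j\in\mathbb{R}^n$, $\Pi_j\in\mathcal{S}^n$, $j\in[k]$: $$\min\ \Big\langle W,I_n-\sum_{j=1}^k\tfrac1{c_j}\Pi_j\Big\rangle\quad\text{s.t.}\quad \sum_{j=1}^k\pi_j=1_n,\quad (\pi_j,\Pi_j)\in\mathcal{S}_{\mathrm{VL}}(c_j)\cap\mathcal{ML}_{\mathrm{VL}}\cap\mathcal{CL}_{\mathrm{VL}}\ \ \forall j\in[k],$$ and the problem (B) in variables $\pi^s_j\in\mathbb{R}^m$, $\Pi^s_j\in\mathcal{S}^m$, $j\in[k]$: $$\min\ \mathrm{tr}(W)-\mathrm{tr}\Big(T^sW(T^s)^\top\sum_{j=1}^k\tfrac1{c_j}\Pi^s_j\Big)$$ subject to - $\sum_{j=1}^k\pi^s_j=1_m$; - $(e^s)^\top\pi^s_j=c_j$ for all $j\in[k]$; - $(\pi^s_h)_i+(\pi^s_h)_j\le1$ for all $h\in[k]$, $(i,j)\in L^s_{\neq}$; - $\begin{bmatrix}1&(\pi^s_j)^\top\\ \pi^s_j&\Pi^s_j\end{bmatrix}\succeq0$ for all $j\in[k]$; - $(\Pi^s_h)_{ij}=0$ for all $h\in[k]$, $(i,j)\in L^s_{\neq}$;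 - $\mathrm{diag}(\Pi^s_j)=\pi^s_j$ for all $j\in[k]$; - $\Pi^s_je^s=c_j\pi^s_j$ for all $j\in[k]$; - $\Pi^s_j\ge0_{m\times m}$ for all $j\in[k]$. Then problems (A) and (B) are equivalent, i.e. for every feasible solution of either problem there is a feasible solution of the other problem with the same objective value.
   Context: $\mathcal{S}^n$ is the set of real symmetric $n\times n$ matrices; $\succeq$ is the positive semidefinite order; $\ge$ between matrices is elementwise; $\langle A,B\rangle=\mathrm{tr}(B^\top A)$; $1_n$ is the all-ones vector; $[n]=\{1,\dots,n\}$; $\mathrm{diag}(M)$ is the vector of diagonal entries of $M$. $\mathcal{S}_{\mathrm{VL}}(c)=\{(\pi,\Pi)\in\mathbb{R}^n\times\mathcal{S}^n:\ 1_n^\top\pi=c,\ \mathrm{diag}(\Pi)=\pi,\ \Pi1_n=c\,\pi,\ \Pi\succeq\pi\pi^\top,\ \Pi\ge 0\}$. $\mathcal{ML}_{\mathrm{VL}}=\{(\pi,\Pi)\in\mathbb{R}^n\times\mathcal{S}^n:\ \pi_i=\pi_j,\ \Pi_{it}=\Pi_{jt}\ \forall t\in[n],\ \forall(i,j)\in L_{=}\}$. $\mathcal{CL}_{\mathrm{VL}}=\{(\pi,\Pi)\in\mathbb{R}^n\times\mathcal{S}^n:\ \pi_i+\pi_j\le1,\ \Pi_{ij}=0,\ \forall(i,j)\in L_{\neq}\}$. Let $G$ be the undirected graph with vertex set $[n]$ and edge set $L_{=}$, and let $B_1,\dots,B_m\subseteq[n]$ ($m\le n$) be the vertex sets of its connected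 components. $T^s$ is the $m\times n$ matrix with $T^s_{ij}=1$ if $j\in B_i$ and $0$ otherwise; $e^s=T^s1_n\in\mathbb{R}^m$ is the vector of component sizes. $L^s_{\neq}\subset[m]\times[m]$ is the set of pairs $(i,j)$ such that there exist $p\in B_i$, $q\in B_j$ with $(p,q)\in L_{\neq}$. *)

theory Defs
  imports "HOL-Analysis.Analysis"
begin

text \<open>
  Index ranges are finite types: \<open>[n]\<close>, \<open>[m]\<close>, \<open>[k]\<close> become \<open>'n\<close>, \<open>'m\<close>, \<open>'k\<close>. The vector
  \<open>1 :: real ^ 'n\<close> is the all-ones vector and \<open>mat 1\<close> the identity matrix; note that \<open>1\<close> at a
  matrix type would be the all-ones matrix.
\<close>

definition symmetric_matrix :: "real ^ 'n ^ 'n \<Rightarrow> bool" where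
  "symmetric_matrix A \<longleftrightarrow> transpose A = A"

definition psd :: "real ^ 'n ^ 'n \<Rightarrow> bool" where
  "psd A \<longleftrightarrow> symmetric_matrix A \<and> (\<forall>x. 0 \<le> x \<bullet> (A *v x))"

definition loewner_ge :: "real ^ 'n ^ 'n \<Rightarrow> real ^ 'n ^ 'n \<Rightarrow> bool"  (infix "\<succeq>" 50) where
  "A \<succeq> B \<longleftrightarrow> psd (A - B)"

definition matrix_inner :: "real ^ 'n ^ 'm \<Rightarrow> real ^ 'n ^ 'm \<Rightarrow> real" where
  "matrix_inner A B = trace (transpose B ** A)"

definition diag_vec :: "real ^ 'n ^ 'n \<Rightarrow> real ^ 'n" where
  "diag_vec M = (\<chi> i. M $ i $ i)"

definition outer :: "real ^ 'n \<Rightarrow> real ^ 'n \<Rightarrow> real ^ 'n ^ 'n" where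
  "outer x y = (\<chi> i j. x $ i * y $ j)"

definition nonneg_matrix :: "real ^ 'n ^ 'm \<Rightarrow> bool" where
  "nonneg_matrix M \<longleftrightarrow> (\<forall>i j. 0 \<le> M $ i $ j)"

text \<open>
  The block matrix with rows \<open>(1, x\<^sup>T)\<close> and \<open>(x, M)\<close>; its extra first row and column have
  index \<open>None\<close>.
\<close>
definition bordered :: "real ^ 'm \<Rightarrow> real ^ 'm ^ 'm \<Rightarrow> real ^ ('m option) ^ ('m option)" where
  "bordered x M = (\<chi> a b.
     case a of
       None \<Rightarrow> (case b of None \<Rightarrow> 1 | Some j \<Rightarrow> x $ j)
     | Some i \<Rightarrow> (case b of None \<Rightarrow> x $ i | Some j \<Rightarrow> M $ i $ j))"

definition S_VL :: "real \<Rightarrow> ((real ^ 'n) \<times> (real ^ 'n ^ 'n)) set" where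
  "S_VL c = {(\<pi>, P). symmetric_matrix P \<and>
     1 \<bullet> \<pi> = c \<and> diag_vec P = \<pi> \<and> P *v 1 = c *\<^sub>R \<pi> \<and>
     P \<succeq> outer \<pi> \<pi> \<and> nonneg_matrix P}"

definition MustLink_VL :: "('n \<times> 'n) set \<Rightarrow> ((real ^ 'n) \<times> (real ^ 'n ^ 'n)) set" where
  "MustLink_VL L_eq = {(\<pi>, P). symmetric_matrix P \<and>
     (\<forall>(i, j) \<in> L_eq. \<pi> $ i = \<pi> $ j \<and> (\<forall>t. P $ i $ t = P $ j $ t))}"

definition CannotLink_VL :: "('n \<times> 'n) set \<Rightarrow> ((real ^ 'n) \<times> (real ^ 'n ^ 'n)) set" where
  "CannotLink_VL L_neq = {(\<pi>, P). symmetric_matrix P \<and>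
     (\<forall>(i, j) \<in> L_neq. \<pi> $ i + \<pi> $ j \<le> 1 \<and> P $ i $ j = 0)}"

text \<open>
  Vertex sets of the connected components of the undirected graph on \<open>'n\<close> with edge set \<open>E\<close>:
  the classes of the relation of being joined by a path, where edges are walked in both directions.
\<close>
definition components_of :: "('n \<times> 'n) set \<Rightarrow> 'n set set" where
  "components_of E = UNIV // (E \<union> E\<inverse>)\<^sup>*"

definition T_s :: "('m \<Rightarrow> 'n set) \<Rightarrow> real ^ 'n ^ 'm" where
  "T_s B = (\<chi> i j. if j \<in> B i then 1 else 0)"

definition e_s :: "('m \<Rightarrow> 'n::finite set) \<Rightarrow> real ^ 'm" where
  "e_s B = T_s B *v 1"

definition L_neq_s :: "('m \<Rightarrow> 'n set) \<Rightarrow> ('n \<times> 'n) set \<Rightarrow> ('m \<times> 'm) set" where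
  "L_neq_s B L_neq = {(i, j). \<exists>p \<in> B i. \<exists>q \<in> B j. (p, q) \<in> L_neq}"

definition feasible_A ::
  "('k::finite \<Rightarrow> nat) \<Rightarrow> ('n::finite \<times> 'n) set \<Rightarrow> ('n \<times> 'n) set \<Rightarrow>
   ('k \<Rightarrow> real ^ 'n) \<Rightarrow> ('k \<Rightarrow> real ^ 'n ^ 'n) \<Rightarrow> bool" where
  "feasible_A c L_eq L_neq \<pi> P \<longleftrightarrow>
     (\<Sum>j\<in>UNIV. \<pi> j) = 1 \<and>
     (\<forall>j. (\<pi> j, P j) \<in> S_VL (real (c j)) \<inter> MustLink_VL L_eq \<inter> CannotLink_VL L_neq)"

definition objective_A ::
  "real ^ 'n ^ 'n \<Rightarrow> ('k::finite \<Rightarrow> nat) \<Rightarrow> ('k \<Rightarrow> real ^ 'n ^ 'n) \<Rightarrow> real" where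
  "objective_A W c P = matrix_inner W (mat 1 - (\<Sum>j\<in>UNIV. (1 / real (c j)) *\<^sub>R P j))"

definition feasible_B ::
  "('k::finite \<Rightarrow> nat) \<Rightarrow> ('m::finite \<Rightarrow> 'n::finite set) \<Rightarrow> ('n \<times> 'n) set \<Rightarrow>
   ('k \<Rightarrow> real ^ 'm) \<Rightarrow> ('k \<Rightarrow> real ^ 'm ^ 'm) \<Rightarrow> bool" where
  "feasible_B c B L_neq \<pi> P \<longleftrightarrow>
     (\<forall>j. symmetric_matrix (P j)) \<and>
     (\<Sum>j\<in>UNIV. \<pi> j) = 1 \<and>
     (\<forall>j. e_s B \<bullet> \<pi> j = real (c j)) \<and>
     (\<forall>h. \<forall>(i, j) \<in> L_neq_s B L_neq. \<pi> h $ i + \<pi> h $ j \<le> 1) \<and>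
     (\<forall>j. psd (bordered (\<pi> j) (P j))) \<and>
     (\<forall>h. \<forall>(i, j) \<in> L_neq_s B L_neq. P h $ i $ j = 0) \<and>
     (\<forall>j. diag_vec (P j) = \<pi> j) \<and>
     (\<forall>j. P j *v e_s B = real (c j) *\<^sub>R \<pi> j) \<and>
     (\<forall>j. nonneg_matrix (P j))"

definition objective_B ::
  "real ^ 'n ^ 'n \<Rightarrow> ('k::finite \<Rightarrow> nat) \<Rightarrow> ('m \<Rightarrow> 'n set) \<Rightarrow> ('k \<Rightarrow> real ^ 'm ^ 'm) \<Rightarrow> real" where
  "objective_B W c B P =
     trace W - trace (T_s B ** W ** transpose (T_s B) ** (\<Sum>j\<in>UNIV. (1 / real (c j)) *\<^sub>R P j))"

end

theory Submission imports Defs begin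

text \<open>
  Let \<open>f\<close> send each point to the index of its must-link component, so that \<open>B a\<close> is the fibre
  of \<open>f\<close> over \<open>a\<close>, and write \<open>T\<close> for \<open>T_s B\<close>. A pair \<open>(\<pi>, P)\<close> with symmetric \<open>P\<close> obeys the must-link
  constraints exactly if it is constant on components, that is, if \<open>\<pi> = T\<^sup>t \<pi>\<^sub>s\<close> and
  \<open>P = T\<^sup>t P\<^sub>s T\<close> for a reduced pair, whose entries are \<open>\<pi> $ i = \<pi>\<^sub>s $ f i\<close> and
  \<open>P $ i $ j = P\<^sub>s $ f i $ f j\<close>. So it suffices to compare the two problems along this lifting map.

  As \<open>f\<close> is onto, entrywise constraints transfer in both directions. The linear constraints
  transfer by moving \<open>T\<close> to the other side, because \<open>T 1 = e_s B\<close>. The semidefinite constraint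
  transfers because \<open>x \<bullet> (T\<^sup>t M T) x = (T x) \<bullet> M (T x)\<close> and \<open>T\<close> is onto, together with the Schur
  complement lemma, which turns the bordered matrix into \<open>P\<^sub>s \<succeq> \<pi>\<^sub>s \<pi>\<^sub>s\<^sup>t\<close>. These facts make up
  \<open>feasible_A_lift_iff\<close>. The objectives agree, by \<open>objective_A_lift\<close>, because the trace is
  invariant under cyclic permutation of a product.
\<close>

section \<open>Schur complement of the unit corner\<close>

lemma sum_UNIV_option:
  "(\<Sum>a\<in>UNIV. g (a :: 'a::finite option)) = g None + (\<Sum>i\<in>UNIV. g (Some i))"
  by (simp add: UNIV_option_conv sum.reindex)

lemma outer_mult_vec: "outer x y *v z = (y \<bullet> z) *\<^sub>R x"
  by (simp add: vec_eq_iff outer_def matrix_vector_mult_def inner_vec_def sum_distrib_left mult_ac)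

lemma symmetric_minus_outer_iff:
  "symmetric_matrix (M - outer x x) \<longleftrightarrow> symmetric_matrix M"
  by (simp add: symmetric_matrix_def vec_eq_iff transpose_def outer_def mult.commute)

lemma symmetric_bordered_iff:
  "symmetric_matrix (bordered x M) \<longleftrightarrow> symmetric_matrix M"
  by (auto simp: symmetric_matrix_def vec_eq_iff transpose_def bordered_def split_option_all)

text \<open>
  Completing the square in the coordinate \<open>t\<close> of the extra row.
\<close>
lemma quadratic_form_bordered:
  fixes z :: "real ^ ('m::finite option)"
  defines "t \<equiv> z $ None" and "y \<equiv> \<chi> i. z $ Some i"
  shows "z \<bullet> (bordered x M *v z) = (t + x \<bullet> y)\<^sup>2 + y \<bullet> ((M - outer x x) *v y)"
proof -
  have none: "(bordered x M *v z) $ None = t + x \<bullet> y"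
    by (simp add: matrix_vector_mult_def sum_UNIV_option bordered_def t_def y_def inner_vec_def)
  have some: "(bordered x M *v z) $ Some i = t * x $ i + (M *v y) $ i" for i
    by (simp add: matrix_vector_mult_def sum_UNIV_option bordered_def t_def y_def)
  have "z \<bullet> (bordered x M *v z) =
      t * (t + x \<bullet> y) + (\<Sum>i\<in>UNIV. y $ i * (t * x $ i + (M *v y) $ i))"
    by (simp add: inner_vec_def[of z] sum_UNIV_option none some) (simp add: t_def y_def)
  also have "(\<Sum>i\<in>UNIV. y $ i * (t * x $ i + (M *v y) $ i)) = t * (x \<bullet> y) + y \<bullet> (M *v y)"
    by (simp add: inner_vec_def sum.distrib sum_distrib_left algebra_simps)
  finally show ?thesis
    by (simp add: matrix_vector_mult_diff_rdistrib outer_mult_vec inner_diff_right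
        inner_commute[of y x] power2_eq_square algebra_simps)
qed

lemma psd_bordered_iff: "psd (bordered x M) \<longleftrightarrow> M \<succeq> outer x x"
proof
  assume psd: "psd (bordered x M)"
  have "0 \<le> y \<bullet> ((M - outer x x) *v y)" for y
  proof -
    \<comment> \<open>The extra coordinate is chosen to make the square vanish.\<close>
    define z where "z = (\<chi> a. case a of None \<Rightarrow> - (x \<bullet> y) | Some i \<Rightarrow> y $ i)"
    have "0 \<le> z \<bullet> (bordered x M *v z)"
      using psd by (simp add: psd_def)
    then show ?thesis
      by (simp add: quadratic_form_bordered z_def)
  qed
  with psd show "M \<succeq> outer x x"
    by (simp add: loewner_ge_def psd_def symmetric_minus_outer_iff symmetric_bordered_iff)
next
  assume "M \<succeq> outer x x"
  then show "psd (bordered x M)"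
    by (simp add: loewner_ge_def psd_def symmetric_minus_outer_iff symmetric_bordered_iff
        quadratic_form_bordered)
qed

section \<open>Lifting along a surjection of index sets\<close>

definition lift_vec :: "('n \<Rightarrow> 'm) \<Rightarrow> real ^ 'm \<Rightarrow> real ^ 'n" where
  "lift_vec f x = (\<chi> i. x $ f i)"

definition lift_mat :: "('n \<Rightarrow> 'm) \<Rightarrow> real ^ 'm ^ 'm \<Rightarrow> real ^ 'n ^ 'n" where
  "lift_mat f M = (\<chi> i j. M $ f i $ f j)"

abbreviation fibres :: "('n \<Rightarrow> 'm) \<Rightarrow> 'm \<Rightarrow> 'n set" where
  "fibres f a \<equiv> f -` {a}"

lemma all_surj_iff: "surj f \<Longrightarrow> (\<forall>i. Q (f i)) \<longleftrightarrow> (\<forall>a. Q a)"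
  by (metis surjD)

lemma lift_vec_eq_iff: "surj f \<Longrightarrow> lift_vec f x = lift_vec f y \<longleftrightarrow> x = y"
  using all_surj_iff[of f "\<lambda>a. x $ a = y $ a"] by (simp add: lift_vec_def vec_eq_iff)

lemma symmetric_lift_mat_iff:
  "surj f \<Longrightarrow> symmetric_matrix (lift_mat f M) \<longleftrightarrow> symmetric_matrix M"
  by (simp add: symmetric_matrix_def lift_mat_def transpose_def vec_eq_iff) (metis surjD)

lemma nonneg_lift_mat_iff:
  "surj f \<Longrightarrow> nonneg_matrix (lift_mat f M) \<longleftrightarrow> nonneg_matrix M"
  by (simp add: nonneg_matrix_def lift_mat_def) (metis surjD)

lemma diag_vec_lift_mat: "diag_vec (lift_mat f M) = lift_vec f (diag_vec M)"
  by (simp add: diag_vec_def lift_mat_def lift_vec_def)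

lemma lift_vec_one: "lift_vec f 1 = 1"
  by (simp add: lift_vec_def vec_eq_iff)

lemma lift_vec_scaleR: "lift_vec f (r *\<^sub>R x) = r *\<^sub>R lift_vec f x"
  by (simp add: lift_vec_def vec_eq_iff)

lemma lift_vec_sum: "lift_vec f (\<Sum>k\<in>K. x k) = (\<Sum>k\<in>K. lift_vec f (x k))"
  by (simp add: lift_vec_def vec_eq_iff)

lemma lift_mat_weighted_sum:
  "lift_mat f (\<Sum>k\<in>K. r k *\<^sub>R M k) = (\<Sum>k\<in>K. r k *\<^sub>R lift_mat f (M k))"
  by (simp add: lift_mat_def vec_eq_iff)

lemma lift_mat_minus_outer:
  "lift_mat f M - outer (lift_vec f x) (lift_vec f x) = lift_mat f (M - outer x x)"
  by (simp add: lift_mat_def lift_vec_def outer_def vec_eq_iff)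

text \<open>
  The matrix form of the lifting lets the linear and semidefinite constraints be transferred by
  matrix algebra, where the entrywise form would require splitting sums over the fibres of \<open>f\<close>.
\<close>
lemma lift_vec_eq_transpose_T_s:
  fixes f :: "'n::finite \<Rightarrow> 'm::finite"
  shows "lift_vec f x = transpose (T_s (fibres f)) *v x"
  by (simp add: lift_vec_def T_s_def matrix_vector_mult_def transpose_def vec_eq_iff
      if_distrib[of "\<lambda>t. t * _"] cong: if_cong)

lemma lift_mat_eq_congruence:
  fixes f :: "'n::finite \<Rightarrow> 'm::finite"
  shows "lift_mat f M = transpose (T_s (fibres f)) ** M ** T_s (fibres f)"
  by (simp add: lift_mat_def T_s_def matrix_matrix_mult_def transpose_def vec_eq_iff
      if_distrib[of "\<lambda>t. t * _"] if_distrib[of "\<lambda>t. _ * t"] cong: if_cong)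

lemma inner_one_lift_vec:
  fixes f :: "'n::finite \<Rightarrow> 'm::finite"
  shows "1 \<bullet> lift_vec f x = e_s (fibres f) \<bullet> x"
  by (metis lift_vec_eq_transpose_T_s e_s_def dot_lmul_matrix transpose_matrix_vector transpose_transpose)

lemma lift_mat_mult_one:
  fixes f :: "'n::finite \<Rightarrow> 'm::finite"
  shows "lift_mat f M *v 1 = lift_vec f (M *v e_s (fibres f))"
  by (simp add: lift_mat_eq_congruence lift_vec_eq_transpose_T_s e_s_def
      matrix_vector_mul_assoc matrix_mul_assoc)

lemma quadratic_form_lift_mat:
  fixes f :: "'n::finite \<Rightarrow> 'm::finite"
  defines "T \<equiv> T_s (fibres f)"
  shows "x \<bullet> (lift_mat f M *v x) = (T *v x) \<bullet> (M *v (T *v x))"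
proof -
  have "x \<bullet> (lift_mat f M *v x) = x \<bullet> (transpose T *v (M *v (T *v x)))"
    by (simp add: lift_mat_eq_congruence T_def matrix_vector_mul_assoc matrix_mul_assoc)
  also have "\<dots> = (T *v x) \<bullet> (M *v (T *v x))"
    by (metis dot_lmul_matrix transpose_matrix_vector transpose_transpose)
  finally show ?thesis .
qed

text \<open>
  A right inverse puts the whole mass of a fibre on one chosen representative.
\<close>
lemma surj_T_s:
  fixes f :: "'n::finite \<Rightarrow> 'm::finite"
  assumes "surj f"
  shows "surj ((*v) (T_s (fibres f)))"
proof (rule surjI)
  fix y :: "real ^ 'm"
  define r where "r = inv f"
  have r: "f (r a) = a" for a
    using assms by (simp add: r_def surj_f_inv_f)
  show "T_s (fibres f) *v (\<chi> i. if i = r (f i) then y $ f i else 0) = y"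
  proof (rule vec_eq_iff[THEN iffD2], rule allI)
    fix a
    have "(T_s (fibres f) *v (\<chi> i. if i = r (f i) then y $ f i else 0)) $ a =
        (\<Sum>i\<in>UNIV. if i = r a then y $ a else 0)"
      unfolding matrix_vector_mult_def T_s_def vec_lambda_beta
      by (rule sum.cong) (auto simp: r)
    then show "(T_s (fibres f) *v (\<chi> i. if i = r (f i) then y $ f i else 0)) $ a = y $ a"
      by simp
  qed
qed

lemma psd_lift_mat_iff:
  fixes f :: "'n::finite \<Rightarrow> 'm::finite"
  assumes "surj f"
  shows "psd (lift_mat f M) \<longleftrightarrow> psd M"
  using all_surj_iff[OF surj_T_s[OF assms], of "\<lambda>y. 0 \<le> y \<bullet> (M *v y)"]
  by (simp add: psd_def symmetric_lift_mat_iff[OF assms] quadratic_form_lift_mat)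

section \<open>Comparing the two problems along the lifting\<close>

lemma S_VL_lift_iff:
  fixes f :: "'n::finite \<Rightarrow> 'm::finite"
  assumes "surj f"
  shows "(lift_vec f x, lift_mat f M) \<in> S_VL r \<longleftrightarrow>
    symmetric_matrix M \<and> e_s (fibres f) \<bullet> x = r \<and> diag_vec M = x \<and>
    M *v e_s (fibres f) = r *\<^sub>R x \<and> psd (bordered x M) \<and> nonneg_matrix M"
  using assms
  by (simp add: S_VL_def symmetric_lift_mat_iff inner_one_lift_vec diag_vec_lift_mat
      lift_vec_eq_iff lift_mat_mult_one lift_vec_scaleR[symmetric] loewner_ge_def
      lift_mat_minus_outer psd_lift_mat_iff nonneg_lift_mat_iff psd_bordered_iff)

lemma MustLink_lift:
  assumes "surj f" "symmetric_matrix M" "\<And>i j. (i, j) \<in> L_eq \<Longrightarrow> f i = f j"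
  shows "(lift_vec f x, lift_mat f M) \<in> MustLink_VL L_eq"
  using assms(3)
  by (auto simp: MustLink_VL_def symmetric_lift_mat_iff assms(1,2))
    (simp_all add: lift_vec_def lift_mat_def)

lemma L_neq_s_fibres: "L_neq_s (fibres f) L_neq = map_prod f f ` L_neq"
  by (force simp: L_neq_s_def)

lemma CannotLink_lift_iff:
  assumes "surj f" "symmetric_matrix M"
  shows "(lift_vec f x, lift_mat f M) \<in> CannotLink_VL L_neq \<longleftrightarrow>
    (\<forall>(a, b) \<in> L_neq_s (fibres f) L_neq. x $ a + x $ b \<le> 1 \<and> M $ a $ b = 0)"
  by (simp add: CannotLink_VL_def symmetric_lift_mat_iff assms L_neq_s_fibres case_prod_unfold)
    (simp add: lift_vec_def lift_mat_def)

lemma feasible_A_lift_iff: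
  fixes f :: "'n::finite \<Rightarrow> 'm::finite"
  assumes surj: "surj f" and L_eq: "\<And>i j. (i, j) \<in> L_eq \<Longrightarrow> f i = f j"
  shows "feasible_A c L_eq L_neq (\<lambda>h. lift_vec f (x h)) (\<lambda>h. lift_mat f (M h)) \<longleftrightarrow>
    feasible_B c (fibres f) L_neq x M"
proof -
  have sum: "(\<Sum>h\<in>UNIV. lift_vec f (x h)) = 1 \<longleftrightarrow> (\<Sum>h\<in>UNIV. x h) = 1"
    using lift_vec_eq_iff[OF surj, of "\<Sum>h\<in>UNIV. x h" 1]
    by (simp add: lift_vec_sum lift_vec_one)
  have "(lift_vec f (x h), lift_mat f (M h)) \<in>
        S_VL (real (c h)) \<inter> MustLink_VL L_eq \<inter> CannotLink_VL L_neq \<longleftrightarrow>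
      (lift_vec f (x h), lift_mat f (M h)) \<in> S_VL (real (c h)) \<and>
      (\<forall>(a, b) \<in> L_neq_s (fibres f) L_neq. x h $ a + x h $ b \<le> 1 \<and> M h $ a $ b = 0)" for h
    \<comment> \<open>Membership of the lifted pair in \<open>S_VL\<close> already entails that \<open>M h\<close> is symmetric.\<close>
  proof (cases "symmetric_matrix (M h)")
    case True
    then show ?thesis
      by (simp add: MustLink_lift[OF surj True L_eq] CannotLink_lift_iff[OF surj True])
  next
    case False
    then show ?thesis
      by (simp add: S_VL_lift_iff[OF surj])
  qed
  then have "feasible_A c L_eq L_neq (\<lambda>h. lift_vec f (x h)) (\<lambda>h. lift_mat f (M h)) \<longleftrightarrow>
      (\<Sum>h\<in>UNIV. x h) = 1 \<and>
      (\<forall>h. (lift_vec f (x h), lift_mat f (M h)) \<in> S_VL (real (c h))) \<and>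
      (\<forall>h. \<forall>(a, b) \<in> L_neq_s (fibres f) L_neq. x h $ a + x h $ b \<le> 1 \<and> M h $ a $ b = 0)"
    unfolding feasible_A_def sum by (simp add: all_conj_distrib)
  then show ?thesis
    by (simp add: feasible_B_def S_VL_lift_iff[OF surj] case_prod_unfold ball_conj_distrib
        all_conj_distrib conj_ac)
qed

text \<open>
  The inner product transposes \<open>T\<^sup>t M T\<close>, which symmetry of \<open>M\<close> undoes; then \<open>T W\<close> is cycled to
  the front of the trace.
\<close>
lemma matrix_inner_lift_mat:
  fixes f :: "'n::finite \<Rightarrow> 'm::finite"
  defines "T \<equiv> T_s (fibres f)"
  assumes "symmetric_matrix M"
  shows "matrix_inner W (lift_mat f M) = trace (T ** W ** transpose T ** M)"
proof -
  have "transpose (lift_mat f M) = lift_mat f M"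
    using assms(2) by (simp add: symmetric_matrix_def lift_mat_def transpose_def vec_eq_iff)
  then have "matrix_inner W (lift_mat f M) = trace ((transpose T ** M) ** (T ** W))"
    by (simp add: matrix_inner_def lift_mat_eq_congruence T_def matrix_mul_assoc)
  also have "\<dots> = trace ((T ** W) ** (transpose T ** M))"
    by (rule trace_mul_sym)
  finally show ?thesis
    by (simp add: matrix_mul_assoc)
qed

lemma matrix_inner_mat_one_minus: "matrix_inner W (mat 1 - X) = trace W - matrix_inner W X"
proof -
  have "transpose (mat 1 - X) ** W = W - transpose X ** W"
    by (simp add: vec_eq_iff matrix_matrix_mult_def transpose_def mat_def left_diff_distrib
        sum_subtractf if_distrib[of "\<lambda>t. t * _"] cong: if_cong)
  then show ?thesis
    by (simp add: matrix_inner_def trace_sub)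
qed

lemma objective_A_lift:
  fixes f :: "'n::finite \<Rightarrow> 'm::finite"
  assumes "\<And>h. symmetric_matrix (M h)"
  shows "objective_A W c (\<lambda>h. lift_mat f (M h)) = objective_B W c (fibres f) M"
proof -
  have "symmetric_matrix (\<Sum>h\<in>UNIV. (1 / real (c h)) *\<^sub>R M h)"
    using assms by (simp add: symmetric_matrix_def transpose_def vec_eq_iff)
  then show ?thesis
    by (simp add: objective_A_def objective_B_def matrix_inner_mat_one_minus
        lift_mat_weighted_sum[symmetric] matrix_inner_lift_mat)
qed

section \<open>Must-link components\<close>

text \<open>
  An indexing of the classes amounts to a surjection onto the index set whose kernel is \<open>R\<close>:
  each point is sent to the index of its class. It is onto because classes are nonempty.
\<close>
lemma quotient_indexing_fibres:
  assumes R: "equiv UNIV R" and B: "bij_betw B UNIV (UNIV // R)"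
  obtains f where "surj f" "B = fibres f" "\<And>i j. f i = f j \<longleftrightarrow> (i, j) \<in> R"
proof
  define f where "f i = inv_into UNIV B (R `` {i})" for i
  have inj: "inj B" and img: "B ` UNIV = UNIV // R"
    using B by (auto simp: bij_betw_def)
  have B_f: "B (f i) = R `` {i}" for i
    unfolding f_def by (rule f_inv_into_f) (simp add: img quotientI)
  show eq: "f i = f j \<longleftrightarrow> (i, j) \<in> R" for i j
    using B_f inj R by (metis UNIV_I eq_equiv_class_iff inj_eq)
  have rep: "\<exists>j. f j = a \<and> B a = R `` {j}" for a
  proof -
    have "B a \<in> UNIV // R"
      using img by blast
    then obtain j where j: "B a = R `` {j}"
      by (rule quotientE)
    then have "B (f j) = B a"
      by (simp add: B_f)
    then have "f j = a"
      by (rule injD[OF inj])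
    with j show ?thesis
      by blast
  qed
  have "i \<in> B a \<longleftrightarrow> f i = a" for i a
  proof -
    obtain j where "f j = a" "B a = R `` {j}"
      using rep by blast
    then show ?thesis
      using eq[of j i] by auto
  qed
  then show "B = fibres f"
    by auto
  have "a \<in> range f" for a
    using rep[of a] by blast
  then show "surj f"
    by blast
qed

lemma equiv_connectivity: "equiv UNIV ((E \<union> E\<inverse>)\<^sup>*)"
  by (intro equivI refl_rtrancl sym_rtrancl trans_rtrancl) (auto simp: sym_def)

lemma constant_on_connected:
  assumes "(i, j) \<in> (E \<union> E\<inverse>)\<^sup>*" and "\<And>u v. (u, v) \<in> E \<Longrightarrow> g u = g v"
  shows "g i = g j"
  using assms(1) by (induction rule: rtrancl_induct) (use assms(2) in auto)

text \<open>
  Any section of \<open>f\<close> reads off the reduced pair, as all points of a component are interchangeable.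
  The second index of \<open>P\<close> is covered by symmetry.
\<close>
lemma MustLink_imp_lift:
  assumes ml: "(x, P) \<in> MustLink_VL L_eq"
    and surj: "surj f" and conn: "\<And>i j. f i = f j \<Longrightarrow> (i, j) \<in> (L_eq \<union> L_eq\<inverse>)\<^sup>*"
  shows "x = lift_vec f (\<chi> a. x $ inv f a)"
    and "P = lift_mat f (\<chi> a b. P $ inv f a $ inv f b)"
proof -
  have f_inv: "f i = f (inv f (f i))" for i
    by (simp add: surj surj_f_inv_f)
  have P_sym: "P $ i $ j = P $ j $ i" for i j
    using ml by (auto simp: MustLink_VL_def symmetric_matrix_def transpose_def vec_eq_iff)
  have x: "x $ i = x $ j" if "f i = f j" for i j
    using conn[OF that] by (rule constant_on_connected) (use ml in \<open>auto simp: MustLink_VL_def\<close>)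
  have P: "P $ i $ t = P $ j $ t" if "f i = f j" for i j t
    using conn[OF that] by (rule constant_on_connected) (use ml in \<open>auto simp: MustLink_VL_def\<close>)
  show "x = lift_vec f (\<chi> a. x $ inv f a)"
    using x[OF f_inv] by (simp add: lift_vec_def vec_eq_iff)
  have "P $ i $ j = P $ inv f (f i) $ inv f (f j)" for i j
    using P[OF f_inv] P_sym by metis
  then show "P = lift_mat f (\<chi> a b. P $ inv f a $ inv f b)"
    by (simp add: lift_mat_def vec_eq_iff)
qed

section \<open>Equivalence of the problems\<close>

theorem theorem6:
  fixes p :: "'n::finite \<Rightarrow> real ^ 'd::finite"
    and W :: "real ^ 'n ^ 'n"
    and c :: "'k::finite \<Rightarrow> nat"
    and L_eq L_neq :: "('n \<times> 'n) set"
    and B :: "'m::finite \<Rightarrow> 'n set"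
  assumes "W = (\<chi> i j. p i \<bullet> p j)"
    and "\<And>j. 0 < c j"
    and "(\<Sum>j\<in>UNIV. c j) = CARD('n)"
    and "bij_betw B UNIV (components_of L_eq)"
  shows "(\<forall>\<pi> P. feasible_A c L_eq L_neq \<pi> P \<longrightarrow>
            (\<exists>\<pi>s Ps. feasible_B c B L_neq \<pi>s Ps \<and> objective_B W c B Ps = objective_A W c P)) \<and>
         (\<forall>\<pi>s Ps. feasible_B c B L_neq \<pi>s Ps \<longrightarrow>
            (\<exists>\<pi> P. feasible_A c L_eq L_neq \<pi> P \<and> objective_A W c P = objective_B W c B Ps))"
proof -
  obtain f where surj: "surj f" and B: "B = fibres f"
    and conn: "\<And>i j. f i = f j \<longleftrightarrow> (i, j) \<in> (L_eq \<union> L_eq\<inverse>)\<^sup>*"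
    using quotient_indexing_fibres[OF equiv_connectivity] assms(4)
    unfolding components_of_def by blast
  have L_eq: "f i = f j" if "(i, j) \<in> L_eq" for i j
    using that conn by auto
  have feasible_iff: "feasible_A c L_eq L_neq (\<lambda>h. lift_vec f (x h)) (\<lambda>h. lift_mat f (M h)) \<longleftrightarrow>
      feasible_B c B L_neq x M" for x M
    unfolding B using surj L_eq by (rule feasible_A_lift_iff)
  have objective: "objective_A W c (\<lambda>h. lift_mat f (Ps h)) = objective_B W c B Ps"
    if "feasible_B c B L_neq \<pi>s Ps" for \<pi>s Ps
    using that unfolding B by (intro objective_A_lift) (simp add: feasible_B_def)
  show ?thesis
  proof (intro conjI allI impI)
    fix \<pi> P
    assume A: "feasible_A c L_eq L_neq \<pi> P"
    define \<pi>s where "\<pi>s h = (\<chi> a. \<pi> h $ inv f a)" for h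
    define Ps where "Ps h = (\<chi> a b. P h $ inv f a $ inv f b)" for h
    have ml: "(\<pi> h, P h) \<in> MustLink_VL L_eq" for h
      using A by (simp add: feasible_A_def)
    have "\<pi> h = lift_vec f (\<pi>s h)" for h
      unfolding \<pi>s_def using ml surj by (rule MustLink_imp_lift(1)) (simp add: conn)
    then have \<pi>: "\<pi> = (\<lambda>h. lift_vec f (\<pi>s h))" ..
    have "P h = lift_mat f (Ps h)" for h
      unfolding Ps_def using ml surj by (rule MustLink_imp_lift(2)) (simp add: conn)
    then have P: "P = (\<lambda>h. lift_mat f (Ps h))" ..
    have "feasible_B c B L_neq \<pi>s Ps"
      using A unfolding \<pi> P feasible_iff .
    moreover have "objective_B W c B Ps = objective_A W c P"
      unfolding P using objective[OF calculation] ..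
    ultimately
    show "\<exists>\<pi>s Ps. feasible_B c B L_neq \<pi>s Ps \<and> objective_B W c B Ps = objective_A W c P"
      by blast
  next
    fix \<pi>s Ps
    assume feasible: "feasible_B c B L_neq \<pi>s Ps"
    then have "feasible_A c L_eq L_neq (\<lambda>h. lift_vec f (\<pi>s h)) (\<lambda>h. lift_mat f (Ps h))"
      unfolding feasible_iff .
    with objective[OF feasible]
    show "\<exists>\<pi> P. feasible_A c L_eq L_neq \<pi> P \<and> objective_A W c P = objective_B W c B Ps"
      by blast
  qed
qed

end
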